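(* Let $\mathcal{L}$ be a relational language. Let $\mathcal{M}$ be a transitive elementarily indivisible $\mathcal{L}$-structure and let $\langle\mathcal{N}_0,\mathcal{N}_1\rangle$ be an elementarily indivisible pair of $\mathcal{L}$-structures. Let $\mathcal{M}_1\subsetneq\mathcal{M}$ be a proper substructure and $\mathcal{M}'\subseteq\mathcal{M}_1$ a substructure such that $\mathcal{M}'\cong\mathcal{M}$ and $\mathcal{M}'\preceq\mathcal{M}$. For $a\in M$ let $\mathcal{N}_a:=\mathcal{N}_1$ if $a\in M_1$ and $\mathcal{N}_a:=\mathcal{N}_0$ if $a\notin M_1$. Then the generalized product $\mathcal{M}[\mathcal{N}_a]^s_{a\in M}$ is elementarily indivisible and is not transitive.
   Context: A structure is elementarily indivisible if for every coloring of its universe in two colors there is a monochromatic substructure isomorphic to it which is an elementary substructure of it. A structure $\mathcal{M}$ is transitive if $\mathrm{Aut}(\mathcal{M})$ acts transitively on $M$. An elementarily indivisible pair is a pair $\langle\mathcal{M}_0,\mathcal{M}_1\rangle$ of elementarily indivisible $\mathcal{L}$-structures with $\mathcal{M}_0\preceq\mathcal{M}_1$ and $\mathcal{M}_0\not\cong\mathcal{M}_1$. Generalized product: for $\mathcal{L}$-structures $\mathcal{M}$ and $\{\mathcal{N}_a\}_{a\in M}$, $\mathcal{M}[\mathcal{N}_a]_{a\in M}$ is the $\mathcal{L}$-structure with universe $\bigcup_{a\in M}\{a\}\times N_a$ where, for each $n$-ary $R\in\mathcal{L}$, $((a_1,b_1),\dots,(a_n,b_n))\in R$ iff either ($a_1=\dots=a_n=a$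 and $\mathcal{N}_a\models R(b_1,\dots,b_n)$) or ($a_i\neq a_j$ for some $i,j$ and $\mathcal{M}\models R(a_1,\dots,a_n)$). $\mathcal{M}[\mathcal{N}_a]^s_{a\in M}$ is its expansion by a new binary relation $s$ interpreted as $\{((a,b_1),(a,b_2)) : a\in M,\ b_1,b_2\in N_a\}$. *)

theory Defs
  imports Main
begin

text \<open>
  A relational language is a set of relation symbols with arities. The symbols form a set rather
  than a whole type so that the empty language is covered. Nullary symbols are allowed.
\<close>

record 'r rlang =
  symbols :: "'r set"
  arity :: "'r \<Rightarrow> nat"

text \<open>Tuples are lists. Only the interpretation of symbols of the language is relevant.\<close>

record ('r, 'a) rstruct =
  universe :: "'a set"
  interp :: "'r \<Rightarrow> 'a list set"

definition tuples :: "'a set \<Rightarrow> nat \<Rightarrow> 'a list set" where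
  "tuples A n = {xs. length xs = n \<and> set xs \<subseteq> A}"

definition is_structure :: "'r rlang \<Rightarrow> ('r, 'a) rstruct \<Rightarrow> bool" where
  "is_structure L M \<longleftrightarrow>
     universe M \<noteq> {} \<and>
     (\<forall>R\<in>symbols L. interp M R \<subseteq> tuples (universe M) (arity L R))"

datatype 'r formula =
    Eq nat nat
  | Atom 'r "nat list"
  | Neg "'r formula"
  | Conj "'r formula" "'r formula"
  | Ex nat "'r formula"

fun is_formula :: "'r rlang \<Rightarrow> 'r formula \<Rightarrow> bool" where
  "is_formula L (Eq i j) \<longleftrightarrow> True"
| "is_formula L (Atom R is) \<longleftrightarrow> R \<in> symbols L \<and> length is = arity L R"
| "is_formula L (Neg \<phi>) \<longleftrightarrow> is_formula L \<phi>"
| "is_formula L (Conj \<phi> \<psi>) \<longleftrightarrow> is_formula L \<phi> \<and> is_formula L \<psi>"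
| "is_formula L (Ex i \<phi>) \<longleftrightarrow> is_formula L \<phi>"

fun satisfies :: "('r, 'a) rstruct \<Rightarrow> (nat \<Rightarrow> 'a) \<Rightarrow> 'r formula \<Rightarrow> bool" where
  "satisfies M v (Eq i j) \<longleftrightarrow> v i = v j"
| "satisfies M v (Atom R is) \<longleftrightarrow> map v is \<in> interp M R"
| "satisfies M v (Neg \<phi>) \<longleftrightarrow> \<not> satisfies M v \<phi>"
| "satisfies M v (Conj \<phi> \<psi>) \<longleftrightarrow> satisfies M v \<phi> \<and> satisfies M v \<psi>"
| "satisfies M v (Ex i \<phi>) \<longleftrightarrow> (\<exists>a\<in>universe M. satisfies M (v(i := a)) \<phi>)"

definition substructure :: "'r rlang \<Rightarrow> ('r, 'a) rstruct \<Rightarrow> ('r, 'a) rstruct \<Rightarrow> bool" where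
  "substructure L A M \<longleftrightarrow>
     is_structure L A \<and> is_structure L M \<and>
     universe A \<subseteq> universe M \<and>
     (\<forall>R\<in>symbols L. interp A R = interp M R \<inter> tuples (universe A) (arity L R))"

definition elementary_substructure ::
    "'r rlang \<Rightarrow> ('r, 'a) rstruct \<Rightarrow> ('r, 'a) rstruct \<Rightarrow> bool" where
  "elementary_substructure L A M \<longleftrightarrow>
     substructure L A M \<and>
     (\<forall>\<phi> v. is_formula L \<phi> \<longrightarrow> range v \<subseteq> universe A \<longrightarrow>
        (satisfies A v \<phi> \<longleftrightarrow> satisfies M v \<phi>))"

definition isomorphism ::
    "'r rlang \<Rightarrow> ('r, 'a) rstruct \<Rightarrow> ('r, 'b) rstruct \<Rightarrow> ('a \<Rightarrow> 'b) \<Rightarrow> bool" where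
  "isomorphism L M N f \<longleftrightarrow>
     bij_betw f (universe M) (universe N) \<and>
     (\<forall>R\<in>symbols L. \<forall>xs\<in>tuples (universe M) (arity L R).
        xs \<in> interp M R \<longleftrightarrow> map f xs \<in> interp N R)"

definition isomorphic :: "'r rlang \<Rightarrow> ('r, 'a) rstruct \<Rightarrow> ('r, 'b) rstruct \<Rightarrow> bool" where
  "isomorphic L M N \<longleftrightarrow> (\<exists>f. isomorphism L M N f)"

definition transitive_structure :: "'r rlang \<Rightarrow> ('r, 'a) rstruct \<Rightarrow> bool" where
  "transitive_structure L M \<longleftrightarrow>
     (\<forall>a\<in>universe M. \<forall>b\<in>universe M. \<exists>f. isomorphism L M M f \<and> f a = b)"

definition elementarily_indivisible :: "'r rlang \<Rightarrow> ('r, 'a) rstruct \<Rightarrow> bool" where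
  "elementarily_indivisible L M \<longleftrightarrow>
     is_structure L M \<and>
     (\<forall>c :: 'a \<Rightarrow> bool. \<exists>A. elementary_substructure L A M \<and> isomorphic L A M \<and>
        (\<exists>k. \<forall>x\<in>universe A. c x = k))"

definition elementarily_indivisible_pair ::
    "'r rlang \<Rightarrow> ('r, 'a) rstruct \<Rightarrow> ('r, 'a) rstruct \<Rightarrow> bool" where
  "elementarily_indivisible_pair L M0 M1 \<longleftrightarrow>
     elementarily_indivisible L M0 \<and> elementarily_indivisible L M1 \<and>
     elementary_substructure L M0 M1 \<and> \<not> isomorphic L M0 M1"

definition gen_product ::
    "('r, 'a) rstruct \<Rightarrow> ('a \<Rightarrow> ('r, 'b) rstruct) \<Rightarrow> ('r, 'a \<times> 'b) rstruct" where
  "gen_product M N =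
     (let U = Sigma (universe M) (\<lambda>a. universe (N a)) in
      \<lparr>universe = U,
       interp = (\<lambda>R. {ps. set ps \<subseteq> U \<and>
         ((\<exists>a\<in>universe M. (\<forall>p\<in>set ps. fst p = a) \<and> map snd ps \<in> interp (N a) R) \<or>
          ((\<exists>p\<in>set ps. \<exists>q\<in>set ps. fst p \<noteq> fst q) \<and> map fst ps \<in> interp M R))})\<rparr>)"

text \<open>
  The expansion by the new binary symbol \<open>s\<close> uses symbols of type \<^typ>\<open>'r option\<close>:
  \<^term>\<open>None\<close> is \<open>s\<close>, and \<^term>\<open>Some R\<close> is the old symbol \<open>R\<close>.
\<close>

definition lang_s :: "'r rlang \<Rightarrow> 'r option rlang" where
  "lang_s L =
     \<lparr>symbols = insert None (Some ` symbols L), arity = case_option 2 (arity L)\<rparr>"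

definition gen_product_s ::
    "('r, 'a) rstruct \<Rightarrow> ('a \<Rightarrow> ('r, 'b) rstruct) \<Rightarrow> ('r option, 'a \<times> 'b) rstruct" where
  "gen_product_s M N =
     \<lparr>universe = universe (gen_product M N),
      interp = case_option
        {[(a, b1), (a, b2)] | a b1 b2. a \<in> universe M \<and> b1 \<in> universe (N a) \<and> b2 \<in> universe (N a)}
        (interp (gen_product M N))\<rparr>"

end

theory Submission
  imports Defs
begin

text \<open>
  Given a coloring, each fibre over \<open>M1\<close> contains a monochromatic elementary copy of \<open>N1\<close>; the colors
  of these copies color the points of \<open>M'\<close>, so some elementary copy \<open>P\<close> of \<open>M\<close> inside \<open>M'\<close> is
  monochromatic for the induced coloring. An isomorphism from \<open>M\<close> to \<open>P\<close> need not respect \<open>M1\<close>, but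
  as \<open>P \<subseteq> M1\<close> every fibre over \<open>P\<close> carries a copy of \<open>N1\<close>, which can be shrunk to a copy of \<open>N0\<close>
  where needed. The result is isomorphic to the whole product. It is an elementary substructure
  because Ehrenfeucht-Fraisse games can be played fibrewise, all fibres being elementarily
  equivalent. Since automorphisms preserve \<open>s\<close>, they restrict to isomorphisms between fibres, and so
  none of them moves a point over \<open>M1\<close> to a point off it.
\<close>

section \<open>Isomorphisms and elementary substructures\<close>

lemma map_in_tuples: "range v \<subseteq> U \<Longrightarrow> length is = n \<Longrightarrow> map v is \<in> tuples U n"
  by (auto simp: tuples_def)

lemma isomorphism_inv:
  assumes "isomorphism L M N f"
  shows "isomorphism L N M (inv_into (universe M) f)"
  unfolding isomorphism_def
proof (intro conjI ballI)
  let ?g = "inv_into (universe M) f"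
  have bij: "bij_betw f (universe M) (universe N)"
    using assms by (simp add: isomorphism_def)
  then show "bij_betw ?g (universe N) (universe M)"
    by (rule bij_betw_inv_into)
  fix R xs
  assume R: "R \<in> symbols L" and xs: "xs \<in> tuples (universe N) (arity L R)"
  have g: "?g y \<in> universe M" "f (?g y) = y" if "y \<in> universe N" for y
    using bij that by (auto simp: bij_betw_def inv_into_into f_inv_into_f)
  have "map ?g xs \<in> tuples (universe M) (arity L R)"
    using xs g(1) by (auto simp: tuples_def)
  moreover have "map f (map ?g xs) = xs"
    using xs g(2) by (auto simp: tuples_def intro!: map_idI)
  ultimately show "xs \<in> interp N R \<longleftrightarrow> map ?g xs \<in> interp M R"
    using assms R by (metis isomorphism_def)
qed

lemma isomorphic_sym: "isomorphic L M N \<Longrightarrow> isomorphic L N M"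
  using isomorphism_inv unfolding isomorphic_def by blast

lemma isomorphism_comp:
  assumes f: "isomorphism L A B f" and g: "isomorphism L B C g"
  shows "isomorphism L A C (g \<circ> f)"
  unfolding isomorphism_def
proof (intro conjI ballI)
  show "bij_betw (g \<circ> f) (universe A) (universe C)"
    using f g by (auto simp: isomorphism_def intro: bij_betw_trans)
  fix R xs
  assume R: "R \<in> symbols L" and xs: "xs \<in> tuples (universe A) (arity L R)"
  have "map f xs \<in> tuples (universe B) (arity L R)"
    using f xs by (auto simp: isomorphism_def tuples_def bij_betw_def)
  then show "xs \<in> interp A R \<longleftrightarrow> map (g \<circ> f) xs \<in> interp C R"
    using f g R xs by (simp add: isomorphism_def)
qed

lemma isomorphic_trans: "isomorphic L A B \<Longrightarrow> isomorphic L B C \<Longrightarrow> isomorphic L A C"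
  using isomorphism_comp unfolding isomorphic_def by blast

lemma satisfies_isomorphism:
  assumes f: "isomorphism L M N f" and "is_formula L \<phi>" and "range v \<subseteq> universe M"
  shows "satisfies M v \<phi> \<longleftrightarrow> satisfies N (f \<circ> v) \<phi>"
  using assms(2,3)
proof (induction \<phi> arbitrary: v)
  case (Eq i j)
  have "inj_on f (universe M)"
    using f by (auto simp: isomorphism_def bij_betw_def)
  then show ?case
    using Eq.prems(2) by (simp add: inj_on_eq_iff range_subsetD)
next
  case (Atom R "is")
  then show ?case
    using f map_in_tuples[of v "universe M" "is"] by (simp add: isomorphism_def comp_def)
next
  case (Ex i \<phi>)
  have img: "universe N = f ` universe M"
    using f by (auto simp: isomorphism_def bij_betw_def)
  have "satisfies M (v(i := a)) \<phi> \<longleftrightarrow> satisfies N ((f \<circ> v)(i := f a)) \<phi>" if "a \<in> universe M" for a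
  proof -
    have "range (v(i := a)) \<subseteq> universe M"
      using Ex.prems(2) that by auto
    then show ?thesis
      using Ex.IH[of "v(i := a)"] Ex.prems(1) by (simp add: fun_upd_comp del: fun_upd_apply)
  qed
  then show ?case
    by (simp add: img del: comp_apply)
qed auto

text \<open>Agreement on atomic formulas already forces the relations of \<open>A\<close> to be the
  restrictions of those of \<open>M\<close>, so the substructure condition need not be checked
  separately.\<close>

lemma elementary_substructureI:
  assumes "is_structure L A" "is_structure L M" "universe A \<subseteq> universe M"
    and sat: "\<And>\<phi> v. is_formula L \<phi> \<Longrightarrow> range v \<subseteq> universe A \<Longrightarrow>
      satisfies A v \<phi> \<longleftrightarrow> satisfies M v \<phi>"
  shows "elementary_substructure L A M"
proof -
  have "xs \<in> interp A R \<longleftrightarrow> xs \<in> interp M R"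
    if R: "R \<in> symbols L" and xs: "xs \<in> tuples (universe A) (arity L R)" for R xs
  proof -
    obtain a where a: "a \<in> universe A"
      using assms(1) by (auto simp: is_structure_def)
    \<comment> \<open>The tuple is read as the values of the variables \<open>0, 1, ...\<close>.
      Later variables get the default \<open>a\<close>, because an assignment has to stay inside
      \<open>A\<close> everywhere.\<close>
    define v where "v i = (if i < length xs then xs ! i else a)" for i
    have "range v \<subseteq> universe A"
      using a xs by (auto simp: v_def tuples_def)
    moreover have "map v [0..<length xs] = xs"
      by (auto simp: v_def intro: nth_equalityI)
    ultimately show ?thesis
      using sat[of "Atom R [0..<length xs]" v] R xs by (simp add: tuples_def)
  qed
  moreover have "interp A R \<subseteq> tuples (universe A) (arity L R)" if "R \<in> symbols L" for R
    using assms(1) that by (simp add: is_structure_def)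
  ultimately have "interp A R = interp M R \<inter> tuples (universe A) (arity L R)"
    if "R \<in> symbols L" for R
    using that by (intro set_eqI) blast
  then show ?thesis
    using assms by (simp add: elementary_substructure_def substructure_def)
qed

lemma elementary_substructureD:
  assumes "elementary_substructure L A M"
  shows "is_structure L A" "is_structure L M" "universe A \<subseteq> universe M"
    "\<And>\<phi> v. is_formula L \<phi> \<Longrightarrow> range v \<subseteq> universe A \<Longrightarrow> satisfies A v \<phi> \<longleftrightarrow> satisfies M v \<phi>"
  using assms by (auto simp: elementary_substructure_def substructure_def)

lemma elementary_substructure_refl: "is_structure L M \<Longrightarrow> elementary_substructure L M M"
  by (rule elementary_substructureI) auto

lemma elementary_substructure_trans:
  assumes AB: "elementary_substructure L A B" and BC: "elementary_substructure L B C"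
  shows "elementary_substructure L A C"
proof (rule elementary_substructureI)
  note AB = elementary_substructureD[OF AB] and BC = elementary_substructureD[OF BC]
  show "is_structure L A" "is_structure L C" "universe A \<subseteq> universe C"
    using AB(1,3) BC(2,3) by auto
  fix \<phi> and v :: "nat \<Rightarrow> _"
  assume \<phi>: "is_formula L \<phi>" and v: "range v \<subseteq> universe A"
  show "satisfies A v \<phi> \<longleftrightarrow> satisfies C v \<phi>"
    using AB(4)[OF \<phi> v] BC(4)[OF \<phi>, of v] v AB(3) by auto
qed

text \<open>Transport of structure along \<open>f\<close>. The copy is kept explicit as the image
  under the same \<open>f\<close>, so that a coloring of \<open>N\<close> can be traced back to
  \<open>A\<close>.\<close>

lemma elementary_substructure_image:
  assumes f: "isomorphism L M N f" and A: "elementary_substructure L A M" and N: "is_structure L N"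
  obtains A' where "elementary_substructure L A' N" "isomorphism L A A' f"
    "universe A' = f ` universe A"
proof -
  note A' = elementary_substructureD[OF A]
  define B where "B = \<lparr>universe = f ` universe A, interp = \<lambda>R. map f ` interp A R\<rparr>"
  have bij: "bij_betw f (universe M) (universe N)"
    using f by (simp add: isomorphism_def)
  then have inj: "inj_on f (universe A)"
    using A'(3) by (auto simp: bij_betw_def intro: inj_on_subset)
  have AB: "isomorphism L A B f"
    unfolding isomorphism_def
  proof (intro conjI ballI)
    show "bij_betw f (universe A) (universe B)"
      using inj by (simp add: B_def bij_betw_def)
    fix R xs
    assume "R \<in> symbols L" and xs: "xs \<in> tuples (universe A) (arity L R)"
    then have sub: "interp A R \<subseteq> tuples (universe A) (arity L R)"
      using A'(1) by (simp add: is_structure_def)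
    have "xs = ys" if "ys \<in> interp A R" "map f xs = map f ys" for ys
      using that xs sub by (intro map_inj_on[OF _ inj_on_subset[OF inj]]) (auto simp: tuples_def)
    then show "xs \<in> interp A R \<longleftrightarrow> map f xs \<in> interp B R"
      by (auto simp: B_def)
  qed
  have "elementary_substructure L B N"
  proof (rule elementary_substructureI)
    show "is_structure L B"
      using A'(1) by (fastforce simp: is_structure_def B_def tuples_def)
    show "universe B \<subseteq> universe N"
      using bij A'(3) by (auto simp: B_def bij_betw_def)
    fix \<phi> and v :: "nat \<Rightarrow> _"
    assume \<phi>: "is_formula L \<phi>" and v: "range v \<subseteq> universe B"
    \<comment> \<open>Pulling \<open>v\<close> back to \<open>A\<close> links the truth values:
      \<open>B\<close> to \<open>A\<close> by isomorphism, \<open>A\<close> to \<open>M\<close> by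
      elementarity, \<open>M\<close> to \<open>N\<close> by isomorphism.\<close>
    define u where "u = inv_into (universe A) f \<circ> v"
    have "inv_into (universe A) f (v i) \<in> universe A \<and> f (inv_into (universe A) f (v i)) = v i" for i
      using v by (auto simp: B_def inv_into_into f_inv_into_f image_subset_iff)
    then have u: "range u \<subseteq> universe A" "f \<circ> u = v"
      by (auto simp: u_def)
    then show "satisfies B v \<phi> \<longleftrightarrow> satisfies N v \<phi>"
      using satisfies_isomorphism[OF AB \<phi> u(1)] satisfies_isomorphism[OF f \<phi>, of u]
        A'(4)[OF \<phi> u(1)] A'(3) by auto
  qed (fact N)
  moreover have "universe B = f ` universe A"
    by (simp add: B_def)
  ultimately show thesis
    using AB that by blast
qed

subsection \<open>Back-and-forth games\<close>

fun fv :: "'r formula \<Rightarrow> nat set" where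
  "fv (Eq i j) = {i, j}"
| "fv (Atom R is) = set is"
| "fv (Neg \<phi>) = fv \<phi>"
| "fv (Conj \<phi> \<psi>) = fv \<phi> \<union> fv \<psi>"
| "fv (Ex i \<phi>) = fv \<phi> - {i}"

lemma finite_fv: "finite (fv \<phi>)"
  by (induction \<phi>) auto

lemma satisfies_cong_fv:
  "(\<And>i. i \<in> fv \<phi> \<Longrightarrow> v i = w i) \<Longrightarrow> satisfies M v \<phi> \<longleftrightarrow> satisfies M w \<phi>"
proof (induction \<phi> arbitrary: v w)
  case (Atom R "is")
  then have "map v is = map w is"
    by simp
  then show ?case
    by (simp only: satisfies.simps)
next
  case (Neg \<phi>)
  have "satisfies M v \<phi> \<longleftrightarrow> satisfies M w \<phi>"
    by (rule Neg.IH) (use Neg.prems in simp)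
  then show ?case
    by simp
next
  case (Conj \<phi> \<psi>)
  have "satisfies M v \<phi> \<longleftrightarrow> satisfies M w \<phi>" "satisfies M v \<psi> \<longleftrightarrow> satisfies M w \<psi>"
    by (rule Conj.IH; use Conj.prems in simp)+
  then show ?case
    by simp
next
  case (Ex i \<phi>)
  have "satisfies M (v(i := a)) \<phi> \<longleftrightarrow> satisfies M (w(i := a)) \<phi>" for a
    by (rule Ex.IH) (use Ex.prems in auto)
  then show ?case
    by simp
qed simp

fun qdepth :: "'r formula \<Rightarrow> nat" where
  "qdepth (Eq i j) = 0"
| "qdepth (Atom R is) = 0"
| "qdepth (Neg \<phi>) = qdepth \<phi>"
| "qdepth (Conj \<phi> \<psi>) = max (qdepth \<phi>) (qdepth \<psi>)"
| "qdepth (Ex i \<phi>) = Suc (qdepth \<phi>)"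

fun symbols_of :: "'r formula \<Rightarrow> 'r set" where
  "symbols_of (Eq i j) = {}"
| "symbols_of (Atom R is) = {R}"
| "symbols_of (Neg \<phi>) = symbols_of \<phi>"
| "symbols_of (Conj \<phi> \<psi>) = symbols_of \<phi> \<union> symbols_of \<psi>"
| "symbols_of (Ex i \<phi>) = symbols_of \<phi>"

lemma finite_symbols_of: "finite (symbols_of \<phi>)"
  by (induction \<phi>) auto

lemma symbols_of_subset: "is_formula L \<phi> \<Longrightarrow> symbols_of \<phi> \<subseteq> symbols L"
  by (induction \<phi>) auto

lemma is_formula_reduct:
  "is_formula L \<phi> \<Longrightarrow> symbols_of \<phi> \<subseteq> symbols L' \<Longrightarrow> arity L' = arity L \<Longrightarrow> is_formula L' \<phi>"
  by (induction \<phi>) auto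

text \<open>A position is a set of pairs, read as a partial map; the first condition makes it well
  defined and injective. The tuple \<open>zs\<close> may be empty, so even the position
  \<open>{}\<close> compares the nullary symbols.\<close>

definition partial_iso ::
    "'r rlang \<Rightarrow> ('r, 'a) rstruct \<Rightarrow> ('r, 'b) rstruct \<Rightarrow> ('a \<times> 'b) set \<Rightarrow> bool" where
  "partial_iso L A B r \<longleftrightarrow>
     (\<forall>(x, y)\<in>r. \<forall>(x', y')\<in>r. x = x' \<longleftrightarrow> y = y') \<and>
     (\<forall>R\<in>symbols L. \<forall>zs. length zs = arity L R \<longrightarrow> set zs \<subseteq> r \<longrightarrow>
        (map fst zs \<in> interp A R \<longleftrightarrow> map snd zs \<in> interp B R))"

text \<open>
  \<open>ef L A B n r\<close>: Duplicator survives \<open>n\<close> rounds of the Ehrenfeucht-Fraisse game from position \<open>r\<close>.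
\<close>

fun ef :: "'r rlang \<Rightarrow> ('r, 'a) rstruct \<Rightarrow> ('r, 'b) rstruct \<Rightarrow> nat \<Rightarrow> ('a \<times> 'b) set \<Rightarrow> bool" where
  "ef L A B 0 r \<longleftrightarrow> partial_iso L A B r"
| "ef L A B (Suc n) r \<longleftrightarrow> ef L A B n r \<and>
     (\<forall>x\<in>universe A. \<exists>y\<in>universe B. ef L A B n (insert (x, y) r)) \<and>
     (\<forall>y\<in>universe B. \<exists>x\<in>universe A. ef L A B n (insert (x, y) r))"

lemma partial_iso_interp:
  "partial_iso L A B r \<Longrightarrow> R \<in> symbols L \<Longrightarrow> length zs = arity L R \<Longrightarrow> set zs \<subseteq> r \<Longrightarrow>
    map fst zs \<in> interp A R \<longleftrightarrow> map snd zs \<in> interp B R"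
  by (simp add: partial_iso_def)

lemma partial_iso_converse:
  assumes "partial_iso L A B r"
  shows "partial_iso L B A (r\<inverse>)"
  unfolding partial_iso_def
proof (intro conjI ballI allI impI)
  fix R zs
  assume R: "R \<in> symbols L" "length zs = arity L R" "set zs \<subseteq> r\<inverse>"
  then have "prod.swap ` set zs \<subseteq> r"
    by auto
  with R show "map fst zs \<in> interp B R \<longleftrightarrow> map snd zs \<in> interp A R"
    using partial_iso_interp[OF assms, of R "map prod.swap zs"] by (auto simp: comp_def)
qed (use assms in \<open>fastforce simp: partial_iso_def\<close>)

lemma ef_converse: "ef L A B n r \<Longrightarrow> ef L B A n (r\<inverse>)"
proof (induction n arbitrary: r)
  case (Suc n)
  have ins: "insert (x, y) (r\<inverse>) = (insert (y, x) r)\<inverse>" for x y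
    by auto
  show ?case
    using Suc unfolding ef.simps ins by meson
qed (simp add: partial_iso_converse)

lemma ef_partial_iso: "ef L A B n r \<Longrightarrow> partial_iso L A B r"
  by (induction n) auto

lemma ef_subset: "ef L A B n r \<Longrightarrow> s \<subseteq> r \<Longrightarrow> ef L A B n s"
proof (induction n arbitrary: r s)
  case 0
  then show ?case
    unfolding ef.simps partial_iso_def by blast
next
  case (Suc n)
  then show ?case
    unfolding ef.simps by (meson insert_mono)
qed

lemma ef_eq_iff: "ef L A B n r \<Longrightarrow> (x, y) \<in> r \<Longrightarrow> (x', y') \<in> r \<Longrightarrow> x = x' \<longleftrightarrow> y = y'"
  using ef_partial_iso unfolding partial_iso_def by fast

text \<open>Each quantifier costs one round: a witness on one side is a move of Spoiler, and
  Duplicator's answer is a witness on the other side. Every pair of values lies in \<open>r\<close>,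
  so free variables need no tracking.\<close>

lemma ef_satisfies:
  assumes "ef L A B n r" "is_formula L \<phi>" "qdepth \<phi> \<le> n" "\<And>i. (v i, w i) \<in> r"
  shows "satisfies A v \<phi> \<longleftrightarrow> satisfies B w \<phi>"
  using assms
proof (induction \<phi> arbitrary: n r v w)
  case (Eq i j)
  then show ?case
    using ef_eq_iff by fastforce
next
  case (Atom R "is")
  have "partial_iso L A B r"
    using Atom ef_partial_iso by blast
  then show ?case
    using Atom.prems partial_iso_interp[of L A B r R "map (\<lambda>i. (v i, w i)) is"]
    by (auto simp: comp_def)
next
  case (Conj \<phi> \<psi>)
  have "satisfies A v \<phi> \<longleftrightarrow> satisfies B w \<phi>" "satisfies A v \<psi> \<longleftrightarrow> satisfies B w \<psi>"
    by (rule Conj.IH(1)[OF Conj.prems(1)] Conj.IH(2)[OF Conj.prems(1)]; use Conj.prems in simp)+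
  then show ?case
    by simp
next
  case (Ex i \<phi>)
  obtain k where n: "n = Suc k" "qdepth \<phi> \<le> k"
    using Ex.prems(3) by (cases n) auto
  have *: "satisfies A (v(i := x)) \<phi> \<longleftrightarrow> satisfies B (w(i := y)) \<phi>"
    if "ef L A B k (insert (x, y) r)" for x y
    by (rule Ex.IH[OF that]) (use Ex.prems n in auto)
  show ?case
    using Ex.prems(1) * unfolding n(1) ef.simps satisfies.simps by meson
qed auto

section \<open>Formulas that describe game positions\<close>

primrec conjs :: "'r formula list \<Rightarrow> 'r formula" where
  "conjs [] = Ex 0 (Eq 0 0)"
| "conjs (\<phi> # \<phi>s) = Conj \<phi> (conjs \<phi>s)"

text \<open>The empty conjunction \<open>Ex 0 (Eq 0 0)\<close> has no free variables and is true
  exactly in a nonempty universe, whence the hypothesis on \<open>M\<close>.\<close>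

lemma satisfies_conjs:
  "universe M \<noteq> {} \<Longrightarrow> satisfies M v (conjs \<phi>s) \<longleftrightarrow> (\<forall>\<phi>\<in>set \<phi>s. satisfies M v \<phi>)"
  by (induction \<phi>s) auto

lemma fv_conjs: "fv (conjs \<phi>s) = (\<Union>\<phi>\<in>set \<phi>s. fv \<phi>)"
  by (induction \<phi>s) auto

lemma is_formula_conjs: "is_formula L (conjs \<phi>s) \<longleftrightarrow> (\<forall>\<phi>\<in>set \<phi>s. is_formula L \<phi>)"
  by (induction \<phi>s) auto

text \<open>Relative to the list this is a complete type with truth pattern \<open>T\<close>. Such
  conjunctions are the building blocks of Hintikka formulas.\<close>

definition sign_conj :: "'r formula list \<Rightarrow> 'r formula set \<Rightarrow> 'r formula" where
  "sign_conj \<phi>s T = conjs (map (\<lambda>\<phi>. if \<phi> \<in> T then \<phi> else Neg \<phi>) \<phi>s)"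

lemma satisfies_sign_conj:
  "universe M \<noteq> {} \<Longrightarrow>
    satisfies M v (sign_conj \<phi>s T) \<longleftrightarrow> (\<forall>\<phi>\<in>set \<phi>s. satisfies M v \<phi> \<longleftrightarrow> \<phi> \<in> T)"
  by (auto simp: sign_conj_def satisfies_conjs simp del: if_image_distrib)

lemma fv_sign_conj: "fv (sign_conj \<phi>s T) = (\<Union>\<phi>\<in>set \<phi>s. fv \<phi>)"
  by (auto simp: sign_conj_def fv_conjs split: if_splits)

lemma is_formula_sign_conj: "is_formula L (sign_conj \<phi>s T) \<longleftrightarrow> (\<forall>\<phi>\<in>set \<phi>s. is_formula L \<phi>)"
  unfolding sign_conj_def is_formula_conjs set_map ball_simps by auto

definition agree ::
    "('r, 'a) rstruct \<Rightarrow> (nat \<Rightarrow> 'a) \<Rightarrow> ('r, 'b) rstruct \<Rightarrow> (nat \<Rightarrow> 'b) \<Rightarrow> 'r formula set \<Rightarrow> bool" where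
  "agree A v B w \<Phi> \<longleftrightarrow> (\<forall>\<phi>\<in>\<Phi>. satisfies A v \<phi> \<longleftrightarrow> satisfies B w \<phi>)"

lemma agree_sym: "agree A v B w \<Phi> \<Longrightarrow> agree B w A v \<Phi>"
  by (auto simp: agree_def)

text \<open>The pattern that \<open>x\<close> realises in \<open>A\<close> is expressed by one
  existential formula. Agreement on that formula yields a \<open>y\<close> with the same pattern in
  \<open>B\<close>.\<close>

lemma agree_forth:
  assumes "agree A v B w (range (\<lambda>T. Ex m (sign_conj \<phi>s T)))" "x \<in> universe A" "universe B \<noteq> {}"
  shows "\<exists>y\<in>universe B. agree A (v(m := x)) B (w(m := y)) (set \<phi>s)"
proof -
  define T where "T = {\<phi>. satisfies A (v(m := x)) \<phi>}"
  have ne: "universe A \<noteq> {}"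
    using assms(2) by blast
  have "satisfies A v (Ex m (sign_conj \<phi>s T))"
    using assms(2) satisfies_sign_conj[OF ne] by (auto simp: T_def)
  then have "satisfies B w (Ex m (sign_conj \<phi>s T))"
    using assms(1) unfolding agree_def by blast
  then obtain y where "y \<in> universe B" "satisfies B (w(m := y)) (sign_conj \<phi>s T)"
    by auto
  then show ?thesis
    using satisfies_sign_conj[OF assms(3)] by (auto simp: agree_def T_def)
qed

text \<open>Only the trace of \<open>T\<close> on the list influences the conjunction, and a finite
  list has finitely many subsets of entries.\<close>

lemma finite_sign_conjs: "finite (range (\<lambda>T. Ex m (sign_conj \<phi>s T)))"
proof -
  have "sign_conj \<phi>s T = sign_conj \<phi>s (T \<inter> set \<phi>s)" for T
    unfolding sign_conj_def by (rule arg_cong[where f = conjs]) auto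
  then have "range (\<lambda>T. Ex m (sign_conj \<phi>s T)) \<subseteq> (\<lambda>T. Ex m (sign_conj \<phi>s T)) ` Pow (set \<phi>s)"
    by fastforce
  then show ?thesis
    by (rule finite_subset) simp
qed

text \<open>
  The set \<open>\<Phi>\<close> must not depend on the structures: in the successor step \<open>agree_forth\<close> packs the
  finitely many formulas for \<open>Suc m\<close> variables into single existential formulas.
\<close>

lemma finitely_many_formulas_determine_ef:
  assumes fin: "finite (symbols L)"
  shows "\<exists>\<Phi>. (finite \<Phi> \<and> (\<forall>\<phi>\<in>\<Phi>. is_formula L \<phi> \<and> fv \<phi> \<subseteq> {..<m})) \<and>
    (\<forall>(A :: ('r, 'a) rstruct) (B :: ('r, 'b) rstruct) v w.
      universe A \<noteq> {} \<longrightarrow> universe B \<noteq> {} \<longrightarrow> agree A v B w \<Phi> \<longrightarrow>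
      ef L A B n ((\<lambda>i. (v i, w i)) ` {..<m}))"
    (is "\<exists>\<Phi>. ?formulas m \<Phi> \<and> ?determine m n \<Phi>")
proof (induction n arbitrary: m)
  case 0
  \<comment> \<open>Without rounds only equalities and atoms in the variables below \<open>m\<close>
    count. Finitely many symbols, each of fixed arity, leave finitely many of them.\<close>
  define \<Phi> where "\<Phi> = (\<lambda>(i, j). Eq i j) ` ({..<m} \<times> {..<m}) \<union>
    (\<Union>R\<in>symbols L. Atom R ` {is. set is \<subseteq> {..<m} \<and> length is = arity L R})"
  have "?formulas m \<Phi>"
    using fin by (auto simp: \<Phi>_def finite_lists_length_eq)
  moreover have "partial_iso L A B ((\<lambda>i. (v i, w i)) ` {..<m})" if agr: "agree A v B w \<Phi>"
    for A :: "('r, 'a) rstruct" and B :: "('r, 'b) rstruct" and v w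
    unfolding partial_iso_def
  proof (intro conjI ballI allI impI; clarify?)
    fix i j
    assume "i < m" "j < m"
    then have "Eq i j \<in> \<Phi>"
      by (auto simp: \<Phi>_def)
    then show "v i = v j \<longleftrightarrow> w i = w j"
      using agr[unfolded agree_def, rule_format, of "Eq i j"] by simp
  next
    fix R zs
    assume R: "R \<in> symbols L" "length zs = arity L R" "set zs \<subseteq> (\<lambda>i. (v i, w i)) ` {..<m}"
    \<comment> \<open>Every pair of the position is indexed by a variable; reading off the indices
      turns the tuple into an atomic formula.\<close>
    then have "zs \<in> lists ((\<lambda>i. (v i, w i)) ` {..<m})"
      by auto
    then obtain "is" where is': "set is \<subseteq> {..<m}" "zs = map (\<lambda>i. (v i, w i)) is"
      unfolding lists_image by auto
    then have "Atom R is \<in> \<Phi>"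
      using R by (auto simp: \<Phi>_def)
    then show "map fst zs \<in> interp A R \<longleftrightarrow> map snd zs \<in> interp B R"
      using agr[unfolded agree_def, rule_format, of "Atom R is"] is'(2) by (simp add: comp_def)
  qed
  then have "?determine m 0 \<Phi>"
    by simp
  ultimately show ?case
    by (intro exI, intro conjI[of "_ \<and> _"])
next
  case (Suc n)
  obtain \<Phi> where "?formulas m \<Phi> \<and> ?determine m n \<Phi>"
    using Suc[of m] by (rule exE)
  note \<Phi> = conjunct1[OF this] conjunct2[OF this]
  obtain \<Psi> where "?formulas (Suc m) \<Psi> \<and> ?determine (Suc m) n \<Psi>"
    using Suc[of "Suc m"] by (rule exE)
  note \<Psi> = conjunct1[OF this] conjunct2[OF this]
  obtain \<psi>s where \<psi>s: "set \<psi>s = \<Psi>"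
    using \<Psi>(1) finite_list by meson
  define X where "X = range (\<lambda>T. Ex m (sign_conj \<psi>s T))"
  have "?formulas m (\<Phi> \<union> X)"
  proof (intro conjI ballI)
    show "finite (\<Phi> \<union> X)"
      using \<Phi>(1) finite_sign_conjs[of m \<psi>s] by (simp add: X_def)
    fix \<phi>
    assume "\<phi> \<in> \<Phi> \<union> X"
    then consider "\<phi> \<in> \<Phi>" | T where "\<phi> = Ex m (sign_conj \<psi>s T)"
      by (auto simp: X_def)
    then have "is_formula L \<phi> \<and> fv \<phi> \<subseteq> {..<m}"
    proof cases
      case 1
      then show ?thesis
        using \<Phi>(1) by simp
    next
      case 2
      then show ?thesis
        using \<Psi>(1) \<psi>s by (auto simp: is_formula_sign_conj fv_sign_conj lessThan_Suc)
    qed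
    then show "is_formula L \<phi>" "fv \<phi> \<subseteq> {..<m}"
      by simp_all
  qed
  moreover have "ef L A B (Suc n) ((\<lambda>i. (v i, w i)) ` {..<m})"
    if ne: "universe A \<noteq> {}" "universe B \<noteq> {}" and agr: "agree A v B w (\<Phi> \<union> X)"
    for A :: "('r, 'a) rstruct" and B :: "('r, 'b) rstruct" and v w
  proof -
    \<comment> \<open>The variable \<open>m\<close>, the first one outside \<open>{..<m}\<close>,
      stores the pair chosen in the first round.\<close>
    have step: "ef L A B n (insert (x, y) ((\<lambda>i. (v i, w i)) ` {..<m}))"
      if "agree A (v(m := x)) B (w(m := y)) \<Psi>" for x y
    proof -
      have "(\<lambda>i. ((v(m := x)) i, (w(m := y)) i)) ` {..<Suc m} =
          insert (x, y) ((\<lambda>i. (v i, w i)) ` {..<m})"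
        by (auto simp: lessThan_Suc)
      then show ?thesis
        using \<Psi>(2)[rule_format, OF ne that] by simp
    qed
    have X: "agree A v B w X" and "agree A v B w \<Phi>"
      using agr by (auto simp: agree_def)
    then have "ef L A B n ((\<lambda>i. (v i, w i)) ` {..<m})"
      using \<Phi>(2)[rule_format, OF ne] by simp
    moreover have "\<exists>y\<in>universe B. ef L A B n (insert (x, y) ((\<lambda>i. (v i, w i)) ` {..<m}))"
      if "x \<in> universe A" for x
      using agree_forth[OF X[unfolded X_def] that ne(2)] step unfolding \<psi>s by meson
    moreover have "\<exists>x\<in>universe A. ef L A B n (insert (x, y) ((\<lambda>i. (v i, w i)) ` {..<m}))"
      if "y \<in> universe B" for y
      using agree_forth[OF agree_sym[OF X[unfolded X_def]] that ne(1)] step agree_sym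
      unfolding \<psi>s by meson
    ultimately show ?thesis
      by simp
  qed
  then have "?determine m (Suc n) (\<Phi> \<union> X)"
    by simp
  ultimately show ?case
    by (intro exI, intro conjI[of "_ \<and> _"])
qed

section \<open>Games between elementarily related structures\<close>

lemma agree_on_formulas_imp_ef:
  assumes "finite (symbols L)" "universe A \<noteq> {}" "universe B \<noteq> {}"
    and "\<And>\<phi>. is_formula L \<phi> \<Longrightarrow> fv \<phi> \<subseteq> {..<m} \<Longrightarrow> satisfies A v \<phi> \<longleftrightarrow> satisfies B w \<phi>"
  shows "ef L A B n ((\<lambda>i. (v i, w i)) ` {..<m})"
  using finitely_many_formulas_determine_ef[OF assms(1), of m n]
proof (elim exE conjE)
  fix \<Phi>
  assume \<Phi>: "\<forall>\<phi>\<in>\<Phi>. is_formula L \<phi> \<and> fv \<phi> \<subseteq> {..<m}"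
    and det: "\<forall>(A :: ('a, 'b) rstruct) (B :: ('a, 'c) rstruct) v w.
      universe A \<noteq> {} \<longrightarrow> universe B \<noteq> {} \<longrightarrow> agree A v B w \<Phi> \<longrightarrow>
      ef L A B n ((\<lambda>i. (v i, w i)) ` {..<m})"
  have "agree A v B w \<Phi>"
    using \<Phi> assms(4) by (simp add: agree_def)
  with assms(2,3) show ?thesis
    by (rule det[rule_format])
qed

text \<open>By elementarity an assignment that enumerates \<open>F\<close> satisfies the same
  formulas in \<open>A\<close> and in \<open>M\<close>, so Duplicator may start from the diagonal of
  \<open>F\<close>.\<close>

lemma elementary_substructure_ef:
  assumes "finite (symbols L)" "elementary_substructure L A M" "finite F" "F \<subseteq> universe A"
  shows "ef L A M n (Id_on F)"
proof -
  note A = elementary_substructureD[OF assms(2)]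
  obtain a where a: "a \<in> universe A"
    using A(1) by (auto simp: is_structure_def)
  obtain xs where xs: "set xs = F"
    using assms(3) finite_list by blast
  define v where "v i = (if i < length xs then xs ! i else a)" for i
  have v: "range v \<subseteq> universe A"
    using a xs assms(4) by (auto simp: v_def)
  have "ef L A M n ((\<lambda>i. (v i, v i)) ` {..<length xs})"
    using assms(1) A v by (intro agree_on_formulas_imp_ef) (auto simp: is_structure_def)
  moreover have "Id_on F \<subseteq> (\<lambda>i. (v i, v i)) ` {..<length xs}"
    using xs by (auto simp: v_def in_set_conv_nth)
  ultimately show ?thesis
    by (rule ef_subset)
qed

text \<open>For \<open>m = 0\<close> only sentences are compared. Their truth does not depend on the
  assignment, and both structures inherit it from \<open>M\<close>.\<close>

lemma elementarily_equivalent_ef: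
  assumes "finite (symbols L)" "elementary_substructure L A M" "elementary_substructure L B M"
  shows "ef L A B n {}"
proof -
  note A = elementary_substructureD[OF assms(2)] and B = elementary_substructureD[OF assms(3)]
  obtain a b where ab: "a \<in> universe A" "b \<in> universe B"
    using A(1) B(1) by (auto simp: is_structure_def)
  have "ef L A B n ((\<lambda>i. (a, b)) ` {..<0::nat})"
  proof (rule agree_on_formulas_imp_ef[where v = "\<lambda>_. a" and w = "\<lambda>_. b"])
    fix \<phi>
    assume \<phi>: "is_formula L \<phi>" "fv \<phi> \<subseteq> {..<0}"
    have "satisfies M (\<lambda>_. a) \<phi> \<longleftrightarrow> satisfies M (\<lambda>_. b) \<phi>"
      by (rule satisfies_cong_fv) (use \<phi>(2) in auto)
    then show "satisfies A (\<lambda>_. a) \<phi> \<longleftrightarrow> satisfies B (\<lambda>_. b) \<phi>"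
      using A(4)[OF \<phi>(1), of "\<lambda>_. a"] B(4)[OF \<phi>(1), of "\<lambda>_. b"] ab by auto
  qed (use assms(1) ab in auto)
  then show ?thesis
    by simp
qed

text \<open>The game lemmas ask for finitely many symbols. A single formula involves only finitely
  many, and elementarity survives discarding the others.\<close>

lemma elementary_substructure_reduct:
  assumes "elementary_substructure L A M" "S \<subseteq> symbols L"
  shows "elementary_substructure (L\<lparr>symbols := S\<rparr>) A M"
proof (rule elementary_substructureI)
  note A = elementary_substructureD[OF assms(1)]
  show "is_structure (L\<lparr>symbols := S\<rparr>) A" "is_structure (L\<lparr>symbols := S\<rparr>) M"
    using A(1,2) assms(2) by (auto simp: is_structure_def)
  fix \<phi> and v :: "nat \<Rightarrow> _"
  assume \<phi>: "is_formula (L\<lparr>symbols := S\<rparr>) \<phi>" and v: "range v \<subseteq> universe A"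
  have "is_formula L \<phi>"
    by (rule is_formula_reduct[OF \<phi>]) (use symbols_of_subset[OF \<phi>] assms(2) in auto)
  then show "satisfies A v \<phi> \<longleftrightarrow> satisfies M v \<phi>"
    using A(4) v by simp
qed (fact elementary_substructureD(3)[OF assms(1)])


subsection \<open>Generalized products\<close>

lemma universe_gen_product: "universe (gen_product M N) = Sigma (universe M) (\<lambda>a. universe (N a))"
  by (simp add: gen_product_def Let_def)

lemma universe_gen_product_s: "universe (gen_product_s M N) = Sigma (universe M) (\<lambda>a. universe (N a))"
  by (simp add: gen_product_s_def universe_gen_product)

text \<open>On the empty tuple the clause for a common base point has a vacuous condition and the
  clause for distinct base points fails, so nullary symbols are decided by the fibres alone.\<close>

lemma interp_gen_product_Nil:
  "[] \<in> interp (gen_product M N) R \<longleftrightarrow> (\<exists>a\<in>universe M. [] \<in> interp (N a) R)"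
  by (simp add: gen_product_def Let_def)

lemma interp_gen_product_fibre:
  assumes "set ps \<subseteq> Sigma (universe M) (\<lambda>a. universe (N a))" "ps \<noteq> []" "\<forall>p\<in>set ps. fst p = a"
  shows "ps \<in> interp (gen_product M N) R \<longleftrightarrow> map snd ps \<in> interp (N a) R"
proof -
  obtain p where p: "p \<in> set ps"
    using assms(2) by (meson last_in_set)
  then have "a \<in> universe M" "fst p = a"
    using assms(1,3) by force+
  then show ?thesis
    using assms p by (auto simp: gen_product_def Let_def)
qed

lemma interp_gen_product_base:
  assumes "set ps \<subseteq> Sigma (universe M) (\<lambda>a. universe (N a))"
    and "p \<in> set ps" "q \<in> set ps" "fst p \<noteq> fst q"
  shows "ps \<in> interp (gen_product M N) R \<longleftrightarrow> map fst ps \<in> interp M R"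
  using assms by (auto simp: gen_product_def Let_def)

lemma interp_gen_product_s_Some: "interp (gen_product_s M N) (Some R) = interp (gen_product M N) R"
  by (simp add: gen_product_s_def)

lemma interp_gen_product_s_None:
  "[p, q] \<in> interp (gen_product_s M N) None \<longleftrightarrow>
    p \<in> Sigma (universe M) (\<lambda>a. universe (N a)) \<and> q \<in> Sigma (universe M) (\<lambda>a. universe (N a)) \<and>
    fst p = fst q"
  by (auto simp: gen_product_s_def)

lemma symbols_lang_s_cases:
  assumes "R \<in> symbols (lang_s L)" "length xs = arity (lang_s L) R"
  obtains x y where "R = None" "xs = [x, y]"
  | R' where "R = Some R'" "R' \<in> symbols L" "length xs = arity L R'"
  using assms by (auto simp: lang_s_def numeral_2_eq_2 length_Suc_conv)

lemma is_structure_gen_product_s: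
  assumes M: "is_structure L M" and N: "\<And>a. a \<in> universe M \<Longrightarrow> is_structure L (N a)"
  shows "is_structure (lang_s L) (gen_product_s M N)"
proof -
  have "universe (gen_product_s M N) \<noteq> {}"
    using assms by (fastforce simp: is_structure_def universe_gen_product_s)
  moreover have "ps \<in> tuples (universe (gen_product_s M N)) (arity L R)"
    if R: "R \<in> symbols L" and ps: "ps \<in> interp (gen_product M N) R" for R ps
  proof -
    have sub: "set ps \<subseteq> universe (gen_product_s M N)"
      using ps by (auto simp: gen_product_def Let_def universe_gen_product_s)
    consider a where "a \<in> universe M" "map snd ps \<in> interp (N a) R" | "map fst ps \<in> interp M R"
      using ps by (auto simp: gen_product_def Let_def)
    then have "length ps = arity L R"
    proof cases
      case 1
      then have "map snd ps \<in> tuples (universe (N a)) (arity L R)"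
        using N R unfolding is_structure_def by blast
      then show ?thesis
        by (simp add: tuples_def)
    next
      case 2
      then have "map fst ps \<in> tuples (universe M) (arity L R)"
        using M R unfolding is_structure_def by blast
      then show ?thesis
        by (simp add: tuples_def)
    qed
    with sub show ?thesis
      by (simp add: tuples_def)
  qed
  ultimately show ?thesis
    unfolding is_structure_def
    by (auto simp: lang_s_def interp_gen_product_s_Some)
      (auto simp: gen_product_s_def universe_gen_product tuples_def)
qed

text \<open>The split behind every argument about relations of a product, with \<open>f\<close> a
  projection to the base: a nullary atom, a tuple inside one fibre, a tuple that meets two
  fibres.\<close>

lemma list_image_cases:
  obtains (Nil) "xs = []" | (uniform) x where "x \<in> set xs" "\<And>y. y \<in> set xs \<Longrightarrow> f y = f x"
    | (distinct) x y where "x \<in> set xs" "y \<in> set xs" "f x \<noteq> f y"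
proof (cases xs)
  case (Cons x ys)
  then have "x \<in> set xs"
    by simp
  show thesis
  proof (cases "\<exists>y\<in>set xs. f y \<noteq> f x")
    case True
    then obtain y where "y \<in> set xs" "f y \<noteq> f x"
      by (elim bexE)
    then show thesis
      using \<open>x \<in> set xs\<close> by (intro distinct)
  next
    case False
    then have "f y = f x" if "y \<in> set xs" for y
      using that by simp
    then show thesis
      by (rule uniform[OF \<open>x \<in> set xs\<close>])
  qed
qed (rule Nil)

text \<open>As \<open>f\<close> is injective, the combined map preserves and reflects lying in a
  common fibre. A tuple and its image thus fall under the same clause, where \<open>g a\<close>
  settles tuples in the fibre over \<open>a\<close> and \<open>f\<close> settles tuples across
  fibres.\<close>

lemma isomorphism_gen_product_s:
  assumes f: "isomorphism L M M2 f"
    and g: "\<And>a. a \<in> universe M \<Longrightarrow> isomorphism L (N a) (N2 (f a)) (g a)"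
  shows "isomorphism (lang_s L) (gen_product_s M N) (gen_product_s M2 N2) (\<lambda>(a, b). (f a, g a b))"
    (is "isomorphism _ _ _ ?h")
  unfolding isomorphism_def
proof (intro conjI ballI)
  let ?U = "Sigma (universe M) (\<lambda>a. universe (N a))"
  let ?U2 = "Sigma (universe M2) (\<lambda>a. universe (N2 a))"
  have bij_f: "bij_betw f (universe M) (universe M2)"
    using f by (simp add: isomorphism_def)
  have bij_g: "bij_betw (g a) (universe (N a)) (universe (N2 (f a)))" if "a \<in> universe M" for a
    using g[OF that] by (simp add: isomorphism_def)
  have img_f: "universe M2 = f ` universe M" and inj_f: "inj_on f (universe M)"
    using bij_f by (auto simp: bij_betw_def)
  have "inj_on ?h ?U"
  proof (rule inj_onI)
    fix p q
    assume pq: "p \<in> ?U" "q \<in> ?U" "?h p = ?h q"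
    then have "f (fst p) = f (fst q)" "fst p \<in> universe M" "fst q \<in> universe M"
      by auto
    then have "fst p = fst q"
      by (rule inj_onD[OF inj_f])
    moreover have "inj_on (g (fst p)) (universe (N (fst p)))"
      using bij_g pq(1) by (auto simp: bij_betw_def)
    moreover have "g (fst p) (snd p) = g (fst p) (snd q)" "snd p \<in> universe (N (fst p))"
      "snd q \<in> universe (N (fst p))"
      using pq \<open>fst p = fst q\<close> by auto
    ultimately show "p = q"
      by (intro prod_eqI) (auto dest: inj_onD)
  qed
  moreover have "?h ` ?U = ?U2"
  proof (intro equalityI subsetI)
    fix q
    assume "q \<in> ?h ` ?U"
    then obtain a b where "a \<in> universe M" "b \<in> universe (N a)" "q = (f a, g a b)"
      by auto
    then show "q \<in> ?U2"
      using bij_betwE[OF bij_f] bij_betwE[OF bij_g] by simp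
  next
    fix q
    assume q: "q \<in> ?U2"
    then obtain a where a: "a \<in> universe M" "fst q = f a"
      using img_f by auto
    then have "snd q \<in> g a ` universe (N a)"
      using q bij_g[OF a(1)] by (auto simp: bij_betw_def)
    then obtain b where "b \<in> universe (N a)" "q = ?h (a, b)"
      using a(2) by (auto simp: prod_eq_iff)
    then show "q \<in> ?h ` ?U"
      using a(1) by (intro image_eqI[of _ _ "(a, b)"]) auto
  qed
  ultimately have bij_h: "bij_betw ?h ?U ?U2"
    by (simp add: bij_betw_def)
  then show "bij_betw ?h (universe (gen_product_s M N)) (universe (gen_product_s M2 N2))"
    by (simp add: universe_gen_product_s)
  have h: "?h p \<in> ?U2" if "p \<in> ?U" for p
    using bij_h that by (auto simp: bij_betw_def)
  have fst_h: "fst (?h p) = fst (?h q) \<longleftrightarrow> fst p = fst q" if "p \<in> ?U" "q \<in> ?U" for p q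
    using that inj_f by (auto simp: inj_on_eq_iff)
  fix R ps
  assume R: "R \<in> symbols (lang_s L)"
    and ps': "ps \<in> tuples (universe (gen_product_s M N)) (arity (lang_s L) R)"
  then have ps: "set ps \<subseteq> ?U" and len: "length ps = arity (lang_s L) R"
    by (auto simp: tuples_def universe_gen_product_s)
  have hps: "set (map ?h ps) \<subseteq> ?U2"
    using ps h by (auto simp del: split_paired_all)
  from R len show "ps \<in> interp (gen_product_s M N) R \<longleftrightarrow>
      map ?h ps \<in> interp (gen_product_s M2 N2) R"
  proof (cases rule: symbols_lang_s_cases)
    case (1 p q)
    then show ?thesis
      using ps h[of p] h[of q] fst_h[of p q] by (simp add: interp_gen_product_s_None)
  next
    case R': (2 R')
    have "ps \<in> interp (gen_product M N) R' \<longleftrightarrow> map ?h ps \<in> interp (gen_product M2 N2) R'"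
    proof (cases rule: list_image_cases[where xs = ps and f = fst])
      case Nil
      have "[] \<in> interp (N a) R' \<longleftrightarrow> [] \<in> interp (N2 (f a)) R'" if "a \<in> universe M" for a
        using g[OF that, unfolded isomorphism_def, THEN conjunct2, rule_format, of R' "[]"] R' Nil
        by (simp add: tuples_def)
      then show ?thesis
        using Nil by (simp add: interp_gen_product_Nil img_f)
    next
      case (uniform p)
      define a where "a = fst p"
      have fibre: "ps \<noteq> []" "\<forall>p\<in>set ps. fst p = a"
        using length_pos_if_in_set[OF uniform(1)] uniform(2) by (simp_all add: a_def)
      have a: "a \<in> universe M"
        using uniform(1) ps by (auto simp: a_def)
      have "map snd ps \<in> tuples (universe (N a)) (arity L R')"
        using ps fibre(2) R'(3) by (fastforce simp: tuples_def)
      then have "map snd ps \<in> interp (N a) R' \<longleftrightarrow> map (g a) (map snd ps) \<in> interp (N2 (f a)) R'"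
        using g[OF a] R'(2) by (simp add: isomorphism_def)
      moreover have "map snd (map ?h ps) = map (g a) (map snd ps)"
        using fibre(2) by auto
      moreover have hfibre: "map ?h ps \<noteq> []" "\<forall>q\<in>set (map ?h ps). fst q = f a"
        using fibre by auto
      ultimately show ?thesis
        unfolding interp_gen_product_fibre[OF ps fibre] interp_gen_product_fibre[OF hps hfibre]
        by argo
    next
      case (distinct p q)
      note base = this
      have "map fst ps \<in> tuples (universe M) (arity L R')"
        using ps R'(3) by (fastforce simp: tuples_def)
      then have "map fst ps \<in> interp M R' \<longleftrightarrow> map f (map fst ps) \<in> interp M2 R'"
        using f R'(2) by (simp add: isomorphism_def)
      moreover have "map fst (map ?h ps) = map f (map fst ps)"
        by auto
      moreover have "map ?h ps \<in> interp (gen_product M2 N2) R' \<longleftrightarrow>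
          map fst (map ?h ps) \<in> interp M2 R'"
      proof (rule interp_gen_product_base[OF hps])
        show "?h p \<in> set (map ?h ps)" "?h q \<in> set (map ?h ps)"
          using base(1,2) by (simp_all only: set_map imageI)
        show "fst (?h p) \<noteq> fst (?h q)"
          using base ps fst_h[of p q] by blast
      qed
      ultimately show ?thesis
        unfolding interp_gen_product_base[OF ps base] by argo
    qed
    then show ?thesis
      by (simp add: R'(1) interp_gen_product_s_Some)
  qed
qed

section \<open>Games on generalized products\<close>

abbreviation base_rel :: "(('a \<times> 'b) \<times> ('c \<times> 'd)) set \<Rightarrow> ('a \<times> 'c) set" where
  "base_rel r \<equiv> map_prod fst fst ` r"

definition fibre_rel :: "(('a \<times> 'b) \<times> ('c \<times> 'd)) set \<Rightarrow> 'a \<Rightarrow> 'c \<Rightarrow> ('b \<times> 'd) set" where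
  "fibre_rel r a c = {(b, d). ((a, b), (c, d)) \<in> r}"

text \<open>
  Duplicator plays the game on the products by playing one game on the base and, for each pair of
  fibres visited so far, one game on these fibres.
\<close>

definition fibrewise_ef ::
    "'r rlang \<Rightarrow> nat \<Rightarrow> ('r, 'a) rstruct \<Rightarrow> ('a \<Rightarrow> ('r, 'b) rstruct) \<Rightarrow>
      ('r, 'c) rstruct \<Rightarrow> ('c \<Rightarrow> ('r, 'd) rstruct) \<Rightarrow> (('a \<times> 'b) \<times> ('c \<times> 'd)) set \<Rightarrow> bool" where
  "fibrewise_ef L n M N M2 N2 r \<longleftrightarrow>
     universe M \<noteq> {} \<and> universe M2 \<noteq> {} \<and>
     r \<subseteq> Sigma (universe M) (\<lambda>a. universe (N a)) \<times> Sigma (universe M2) (\<lambda>a. universe (N2 a)) \<and>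
     ef L M M2 n (base_rel r) \<and>
     (\<forall>(a, c)\<in>base_rel r. ef L (N a) (N2 c) n (fibre_rel r a c)) \<and>
     (\<forall>a\<in>universe M. \<forall>c\<in>universe M2. ef L (N a) (N2 c) n {})"

lemma fibrewise_ef_converse:
  assumes "fibrewise_ef L n M N M2 N2 r"
  shows "fibrewise_ef L n M2 N2 M N (r\<inverse>)"
proof -
  have base: "base_rel (r\<inverse>) = (base_rel r)\<inverse>"
    by force
  have fibre: "fibre_rel (r\<inverse>) c a = (fibre_rel r a c)\<inverse>" for a c
    by (auto simp: fibre_rel_def)
  have "ef L (N2 c) (N a) n {}" if "ef L (N a) (N2 c) n {}" for a c
    using ef_converse[OF that] by simp
  then show ?thesis
    using assms unfolding fibrewise_ef_def base fibre
    by (auto intro!: ef_converse simp del: image_iff)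
qed

lemma fibrewise_ef_Suc:
  assumes "fibrewise_ef L (Suc n) M N M2 N2 r"
  shows "fibrewise_ef L n M N M2 N2 r"
  using assms unfolding fibrewise_ef_def by auto

text \<open>If the fibre over \<open>a\<close> was visited before, its partner \<open>c\<close> is
  forced and the base position stays put. Otherwise the base game supplies \<open>c\<close>, and a
  fresh game is opened on the two fibres. The answer \<open>d\<close> then comes from the game on
  these fibres.\<close>

lemma fibrewise_ef_forth:
  assumes r: "fibrewise_ef L (Suc n) M N M2 N2 r"
    and p: "p \<in> Sigma (universe M) (\<lambda>a. universe (N a))"
  shows "\<exists>q \<in> Sigma (universe M2) (\<lambda>a. universe (N2 a)). fibrewise_ef L n M N M2 N2 (insert (p, q) r)"
proof -
  obtain a b where ab: "p = (a, b)" "a \<in> universe M" "b \<in> universe (N a)"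
    using p by auto
  have r': "fibrewise_ef L n M N M2 N2 r"
    using r by (rule fibrewise_ef_Suc)
  have empty: "ef L (N a) (N2 c) (Suc n) {}" if "c \<in> universe M2" for c
    using r ab(2) that unfolding fibrewise_ef_def by blast
  have fibre_ins: "fibre_rel (insert ((a, b), (c, d)) r) a' c' =
      (if (a', c') = (a, c) then insert (b, d) (fibre_rel r a c) else fibre_rel r a' c')" for c d a' c'
    by (auto simp: fibre_rel_def)
  \<comment> \<open>The base game has used its round here, while the fibre game keeps
    \<open>Suc n\<close> rounds, because the move \<open>b\<close> is still to be answered.\<close>
  have "\<exists>c\<in>universe M2. ef L M M2 n (insert (a, c) (base_rel r)) \<and>
      ef L (N a) (N2 c) (Suc n) (fibre_rel r a c)"
  proof (cases "\<exists>c. (a, c) \<in> base_rel r")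
    case True
    then obtain c where c: "(a, c) \<in> base_rel r"
      by blast
    then have "insert (a, c) (base_rel r) = base_rel r" "c \<in> universe M2"
      using r unfolding fibrewise_ef_def by auto
    then show ?thesis
      using r c unfolding fibrewise_ef_def by (intro bexI[of _ c]) auto
  next
    case False
    obtain c where c: "c \<in> universe M2" "ef L M M2 n (insert (a, c) (base_rel r))"
      using r ab(2) unfolding fibrewise_ef_def ef.simps by meson
    have "fibre_rel r a c = {}"
      using False by (force simp: fibre_rel_def)
    then show ?thesis
      using c empty by auto
  qed
  then obtain c where c: "c \<in> universe M2" "ef L M M2 n (insert (a, c) (base_rel r))"
    "ef L (N a) (N2 c) (Suc n) (fibre_rel r a c)"
    by blast
  then obtain d where d: "d \<in> universe (N2 c)" "ef L (N a) (N2 c) n (insert (b, d) (fibre_rel r a c))"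
    using ab(3) unfolding ef.simps by meson
  have "\<forall>(a', c')\<in>insert (a, c) (base_rel r).
      ef L (N a') (N2 c') n (fibre_rel (insert ((a, b), (c, d)) r) a' c')"
    using r' d(2) unfolding fibrewise_ef_def fibre_ins by auto
  moreover have "base_rel (insert ((a, b), (c, d)) r) = insert (a, c) (base_rel r)"
    by simp
  ultimately have "fibrewise_ef L n M N M2 N2 (insert ((a, b), (c, d)) r)"
    using r' ab c d unfolding fibrewise_ef_def by (simp only:) auto
  then show ?thesis
    using ab(1) c(1) d(1) by (intro bexI[of _ "(c, d)"]) auto
qed

text \<open>The base game matches equalities of base points, so \<open>s\<close> is respected and
  corresponding tuples fall under the same clause. A tuple inside one fibre is then settled by the
  game on that fibre, a tuple across fibres by the base game.\<close>

lemma fibrewise_ef_partial_iso: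
  assumes r: "fibrewise_ef L n M N M2 N2 r"
  shows "partial_iso (lang_s L) (gen_product_s M N) (gen_product_s M2 N2) r"
proof -
  let ?U = "Sigma (universe M) (\<lambda>a. universe (N a))"
  let ?U2 = "Sigma (universe M2) (\<lambda>a. universe (N2 a))"
  have sub: "p \<in> ?U" "q \<in> ?U2" if "(p, q) \<in> r" for p q
    using r that by (auto simp: fibrewise_ef_def)
  have base: "ef L M M2 n (base_rel r)"
    using r by (simp add: fibrewise_ef_def)
  have fibre: "ef L (N a) (N2 c) n (fibre_rel r a c)" if "(a, c) \<in> base_rel r" for a c
    using r that unfolding fibrewise_ef_def by blast
  have base_mem: "(fst p, fst q) \<in> base_rel r" if "(p, q) \<in> r" for p q
    using that by force
  have fst_eq: "fst p = fst p' \<longleftrightarrow> fst q = fst q'" if "(p, q) \<in> r" "(p', q') \<in> r" for p q p' q'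
    using ef_eq_iff[OF base base_mem[OF that(1)] base_mem[OF that(2)]] .
  have eq: "p = p' \<longleftrightarrow> q = q'" if pq: "(p, q) \<in> r" "(p', q') \<in> r" for p q p' q'
  proof (cases "fst p = fst p'")
    case True
    then have "fst q = fst q'"
      using fst_eq pq by blast
    then have "(snd p, snd q) \<in> fibre_rel r (fst p) (fst q)" "(snd p', snd q') \<in> fibre_rel r (fst p) (fst q)"
      using pq True by (auto simp: fibre_rel_def) (metis prod.collapse)
    then have "snd p = snd p' \<longleftrightarrow> snd q = snd q'"
      using ef_eq_iff[OF fibre[OF base_mem[OF pq(1)]]] by blast
    then show ?thesis
      using True \<open>fst q = fst q'\<close> by (simp add: prod_eq_iff)
  next
    case False
    then show ?thesis
      using fst_eq[OF pq] by auto
  qed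
  have "map fst zs \<in> interp (gen_product_s M N) R \<longleftrightarrow> map snd zs \<in> interp (gen_product_s M2 N2) R"
    if R: "R \<in> symbols (lang_s L)" "length zs = arity (lang_s L) R" and zs: "set zs \<subseteq> r" for R zs
    using R
  proof (cases rule: symbols_lang_s_cases)
    case (1 x y)
    have "(fst x, snd x) \<in> r" "(fst y, snd y) \<in> r"
      using zs 1 by auto
    from sub[OF this(1)] sub[OF this(2)] fst_eq[OF this] show ?thesis
      using 1 by (simp add: interp_gen_product_s_None)
  next
    case R': (2 R')
    have U: "set (map fst zs) \<subseteq> ?U" "set (map snd zs) \<subseteq> ?U2"
      using zs sub by auto
    have fst_eq': "fst (fst x) = fst (fst y) \<longleftrightarrow> fst (snd x) = fst (snd y)"
      if "x \<in> set zs" "y \<in> set zs" for x y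
      using that zs fst_eq[of "fst x" "snd x" "fst y" "snd y"] by auto
    have "map fst zs \<in> interp (gen_product M N) R' \<longleftrightarrow> map snd zs \<in> interp (gen_product M2 N2) R'"
    proof (cases rule: list_image_cases[where xs = zs and f = "fst \<circ> fst"])
      case Nil
      \<comment> \<open>The empty position between any two fibres already compares nullary symbols,
        so either all fibres satisfy \<open>R'\<close> or none does.\<close>
      have "[] \<in> interp (N a) R' \<longleftrightarrow> [] \<in> interp (N2 c) R'"
        if "a \<in> universe M" "c \<in> universe M2" for a c
      proof -
        have "ef L (N a) (N2 c) n {}"
          using r that unfolding fibrewise_ef_def by blast
        then show ?thesis
          using partial_iso_interp[OF ef_partial_iso, of L "N a" "N2 c" n "{}" R' "[]"] R' Nil by simp
      qed
      moreover have "universe M \<noteq> {}" "universe M2 \<noteq> {}"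
        using r by (auto simp: fibrewise_ef_def)
      ultimately show ?thesis
        using Nil by (auto simp: interp_gen_product_Nil)
    next
      case (uniform x)
      let ?a = "fst (fst x)" and ?c = "fst (snd x)"
      have ac: "(?a, ?c) \<in> base_rel r"
        using uniform(1) zs base_mem[of "fst x" "snd x"] by auto
      have same: "fst (fst y) = ?a" "fst (snd y) = ?c" if y: "y \<in> set zs" for y
      proof -
        show "fst (fst y) = ?a"
          using uniform(2)[OF y] by simp
        then show "fst (snd y) = ?c"
          using fst_eq'[OF y uniform(1)] by simp
      qed
      let ?ws = "map (map_prod snd snd) zs"
      have "set ?ws \<subseteq> fibre_rel r ?a ?c"
      proof
        fix w
        assume "w \<in> set ?ws"
        then obtain y where y: "y \<in> set zs" "w = map_prod snd snd y"
          by auto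
        then have "((?a, snd (fst y)), (?c, snd (snd y))) = y"
          using same[of y] by (simp add: prod_eq_iff)
        then show "w \<in> fibre_rel r ?a ?c"
          using y zs by (auto simp: fibre_rel_def map_prod_def split_beta)
      qed
      then have "map fst ?ws \<in> interp (N ?a) R' \<longleftrightarrow> map snd ?ws \<in> interp (N2 ?c) R'"
        using partial_iso_interp[OF ef_partial_iso[OF fibre[OF ac]], of R' ?ws] R'
        by simp
      moreover have "map fst ?ws = map snd (map fst zs)" "map snd ?ws = map snd (map snd zs)"
        by auto
      moreover have "zs \<noteq> []"
        using uniform(1) by auto
      ultimately show ?thesis
        using interp_gen_product_fibre[OF U(1), of ?a R'] interp_gen_product_fibre[OF U(2), of ?c R']
          same by simp
    next
      case (distinct x y)
      let ?ws = "map (map_prod fst fst) zs"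
      have "set ?ws \<subseteq> base_rel r"
        using zs by auto
      then have "map fst ?ws \<in> interp M R' \<longleftrightarrow> map snd ?ws \<in> interp M2 R'"
        using partial_iso_interp[OF ef_partial_iso[OF base], of R' ?ws] R' by simp
      moreover have "map fst ?ws = map fst (map fst zs)" "map snd ?ws = map fst (map snd zs)"
        by auto
      moreover have "fst (snd x) \<noteq> fst (snd y)"
        using distinct fst_eq' by auto
      ultimately show ?thesis
        using interp_gen_product_base[OF U(1), of "fst x" "fst y" R']
          interp_gen_product_base[OF U(2), of "snd x" "snd y" R'] distinct by simp
    qed
    then show ?thesis
      by (simp add: R'(1) interp_gen_product_s_Some)
  qed
  with eq show ?thesis
    unfolding partial_iso_def by blast
qed

text \<open>Induction on the rounds: \<open>fibrewise_ef_forth\<close> answers moves on the left,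
  and the same lemma for the converse position answers moves on the right.\<close>

lemma fibrewise_ef_imp_ef:
  "fibrewise_ef L n M N M2 N2 r \<Longrightarrow> ef (lang_s L) (gen_product_s M N) (gen_product_s M2 N2) n r"
proof (induction n arbitrary: r)
  case 0
  then show ?case
    using fibrewise_ef_partial_iso by simp
next
  case (Suc n)
  have "\<exists>q \<in> Sigma (universe M2) (\<lambda>a. universe (N2 a)).
      ef (lang_s L) (gen_product_s M N) (gen_product_s M2 N2) n (insert (p, q) r)"
    if "p \<in> Sigma (universe M) (\<lambda>a. universe (N a))" for p
    using fibrewise_ef_forth[OF Suc.prems that] Suc.IH by blast
  moreover have "\<exists>p \<in> Sigma (universe M) (\<lambda>a. universe (N a)).
      ef (lang_s L) (gen_product_s M N) (gen_product_s M2 N2) n (insert (p, q) r)"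
    if q: "q \<in> Sigma (universe M2) (\<lambda>a. universe (N2 a))" for q
  proof -
    obtain p where "p \<in> Sigma (universe M) (\<lambda>a. universe (N a))"
      "fibrewise_ef L n M2 N2 M N (insert (q, p) (r\<inverse>))"
      using fibrewise_ef_forth[OF fibrewise_ef_converse[OF Suc.prems] q] by blast
    moreover have "(insert (q, p) (r\<inverse>))\<inverse> = insert (p, q) r"
      by auto
    ultimately show ?thesis
      using fibrewise_ef_converse[of L n M2 N2 M N "insert (q, p) (r\<inverse>)"] Suc.IH by auto
  qed
  ultimately show ?case
    using Suc.IH[OF fibrewise_ef_Suc[OF Suc.prems]] unfolding ef.simps universe_gen_product_s by blast
qed

text \<open>All fibres of both products are elementary in the one structure \<open>K\<close>, hence
  elementarily equivalent, so Duplicator can open a game on any pair of fibres. The diagonal of the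
  parameters then serves as starting position.\<close>

lemma elementary_substructure_gen_product_s:
  fixes M M2 :: "('r, 'a) rstruct" and N N2 :: "'a \<Rightarrow> ('r, 'b) rstruct"
  assumes M: "elementary_substructure L M M2"
    and N: "\<And>a. a \<in> universe M \<Longrightarrow> elementary_substructure L (N a) (N2 a)"
    and N2: "\<And>a. a \<in> universe M2 \<Longrightarrow> elementary_substructure L (N2 a) K"
  shows "elementary_substructure (lang_s L) (gen_product_s M N) (gen_product_s M2 N2)"
proof (rule elementary_substructureI)
  note M' = elementary_substructureD[OF M]
  note N' = elementary_substructureD[OF N]
  note N2' = elementary_substructureD[OF N2]
  show "is_structure (lang_s L) (gen_product_s M N)" "is_structure (lang_s L) (gen_product_s M2 N2)"
    by (intro is_structure_gen_product_s M' N' N2'; assumption)+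
  show sub: "universe (gen_product_s M N) \<subseteq> universe (gen_product_s M2 N2)"
    using M'(3) N'(3) unfolding universe_gen_product_s by (intro Sigma_mono) auto
  fix \<phi> and v :: "nat \<Rightarrow> 'a \<times> 'b"
  assume \<phi>: "is_formula (lang_s L) \<phi>" and v: "range v \<subseteq> universe (gen_product_s M N)"
  \<comment> \<open>\<open>S\<close> is the finite set of old symbols in \<phi>;
    \<open>lang_s\<close> adds the symbol \<open>s\<close> again.\<close>
  define S where "S = {R. Some R \<in> symbols_of \<phi>}"
  let ?L = "L\<lparr>symbols := S\<rparr>"
  have "finite S"
    unfolding S_def using finite_vimageI[OF finite_symbols_of[of \<phi>], of Some] by (simp add: vimage_def)
  have S: "S \<subseteq> symbols L"
    using symbols_of_subset[OF \<phi>] by (auto simp: S_def lang_s_def)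
  have "symbols_of \<phi> \<subseteq> symbols (lang_s ?L)"
  proof
    fix R
    assume "R \<in> symbols_of \<phi>"
    then show "R \<in> symbols (lang_s ?L)"
      by (cases R) (auto simp: lang_s_def S_def)
  qed
  then have \<phi>S: "is_formula (lang_s ?L) \<phi>"
    by (rule is_formula_reduct[OF \<phi>]) (simp add: lang_s_def)
  \<comment> \<open>The starting position has to be finite, so \<open>v\<close> is collapsed to an
    assignment of finite range that agrees with it on the free variables. The default
    \<open>v 0\<close> lies in the product.\<close>
  define w where "w i = (if i \<in> fv \<phi> then v i else v 0)" for i
  have "range w \<subseteq> insert (v 0) (v ` fv \<phi>)"
    by (auto simp: w_def)
  then have fin: "finite (range w)"
    by (rule finite_subset) (simp add: finite_fv)
  have w: "range w \<subseteq> universe (gen_product_s M N)"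
    using v by (auto simp: w_def)
  let ?r = "Id_on (range w)"
  \<comment> \<open>A diagonal position projects to diagonals on the base and on each fibre, which
    is where elementarity of \<open>M\<close> in \<open>M2\<close> and of \<open>N a\<close> in
    \<open>N2 a\<close> enters.\<close>
  have base: "base_rel ?r = Id_on (fst ` range w)"
    by force
  have fibre: "fibre_rel ?r a a = Id_on {b. (a, b) \<in> range w}" for a
    by (auto simp: fibre_rel_def)
  have "ef ?L M M2 n (base_rel ?r)" for n
    unfolding base using \<open>finite S\<close> fin w S
    by (intro elementary_substructure_ef elementary_substructure_reduct M) (auto simp: universe_gen_product_s)
  moreover have "ef ?L (N a) (N2 a) n (fibre_rel ?r a a)" if "a \<in> fst ` range w" for a n
  proof -
    have "{b. (a, b) \<in> range w} \<subseteq> snd ` range w"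
      by (metis (mono_tags, lifting) image_eqI mem_Collect_eq snd_conv subsetI)
    then have "finite {b. (a, b) \<in> range w}"
      using fin finite_subset by blast
    moreover have "a \<in> universe M"
      using w that unfolding universe_gen_product_s by fastforce
    moreover have "{b. (a, b) \<in> range w} \<subseteq> universe (N a)"
      using w unfolding universe_gen_product_s by blast
    ultimately show ?thesis
      unfolding fibre using \<open>finite S\<close> S
      by (intro elementary_substructure_ef elementary_substructure_reduct N) auto
  qed
  moreover have "ef ?L (N a) (N2 c) n {}" if "a \<in> universe M" "c \<in> universe M2" for a c n
  proof (rule elementarily_equivalent_ef)
    show "elementary_substructure ?L (N a) K"
      using that M'(3) S
      by (intro elementary_substructure_reduct elementary_substructure_trans[OF N N2]) auto
    show "elementary_substructure ?L (N2 c) K"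
      using that S by (intro elementary_substructure_reduct N2) auto
  qed (use \<open>finite S\<close> in simp)
  moreover have "?r \<subseteq> Sigma (universe M) (\<lambda>a. universe (N a)) \<times> Sigma (universe M2) (\<lambda>a. universe (N2 a))"
    using w sub unfolding universe_gen_product_s by (auto simp del: mem_Sigma_iff)
  moreover have "universe M \<noteq> {}" "universe M2 \<noteq> {}"
    using M'(1,2) by (simp_all add: is_structure_def)
  ultimately have "fibrewise_ef ?L n M N M2 N2 ?r" for n
    unfolding fibrewise_ef_def base by auto
  then have "satisfies (gen_product_s M N) w \<phi> \<longleftrightarrow> satisfies (gen_product_s M2 N2) w \<phi>"
    by (intro ef_satisfies[OF fibrewise_ef_imp_ef \<phi>S order_refl]) auto
  moreover have "satisfies (gen_product_s M N) v \<phi> \<longleftrightarrow> satisfies (gen_product_s M N) w \<phi>"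
    "satisfies (gen_product_s M2 N2) v \<phi> \<longleftrightarrow> satisfies (gen_product_s M2 N2) w \<phi>"
    by (rule satisfies_cong_fv, simp add: w_def)+
  ultimately show "satisfies (gen_product_s M N) v \<phi> \<longleftrightarrow> satisfies (gen_product_s M2 N2) v \<phi>"
    by simp
qed

section \<open>Transfer of indivisibility, and automorphisms acting on fibres\<close>

lemma elementarily_indivisible_isomorphic:
  assumes M: "elementarily_indivisible L M" and iso: "isomorphic L M N" and N: "is_structure L N"
  shows "elementarily_indivisible L N"
  unfolding elementarily_indivisible_def
proof (intro conjI allI N)
  fix c :: "_ \<Rightarrow> bool"
  obtain f where f: "isomorphism L M N f"
    using iso by (auto simp: isomorphic_def)
  obtain A k where A: "elementary_substructure L A M" "isomorphic L A M" "\<forall>x\<in>universe A. (c \<circ> f) x = k"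
    using M unfolding elementarily_indivisible_def by blast
  obtain A' where A': "elementary_substructure L A' N" "isomorphism L A A' f" "universe A' = f ` universe A"
    using elementary_substructure_image[OF f A(1) N] .
  have "isomorphic L A A'"
    using A'(2) by (auto simp: isomorphic_def)
  then have "isomorphic L A' N"
    using A(2) iso isomorphic_sym isomorphic_trans by metis
  then show "\<exists>A. elementary_substructure L A N \<and> isomorphic L A N \<and> (\<exists>k. \<forall>x\<in>universe A. c x = k)"
    using A'(1,3) A(3) by (intro exI[of _ A']) auto
qed

text \<open>The fibres are the classes of \<open>s\<close>, so an automorphism that sends one point
  over \<open>a\<close> to a point over \<open>a'\<close> maps the whole fibre onto the other. On
  nonempty tuples of a fibre the product has the relations of that fibre; a nullary symbol cannot be
  localised in this way, hence the hypothesis on \<open>[]\<close>.\<close>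

lemma isomorphic_fibres:
  assumes h: "isomorphism (lang_s L) (gen_product_s M N) (gen_product_s M N) h"
    and h0: "h (a, b0) = (a', b0')" and a: "a \<in> universe M" "b0 \<in> universe (N a)"
    and Nil: "\<And>R. R \<in> symbols L \<Longrightarrow> [] \<in> interp (N a) R \<longleftrightarrow> [] \<in> interp (N a') R"
  shows "isomorphic L (N a) (N a')"
proof -
  let ?U = "Sigma (universe M) (\<lambda>a. universe (N a))"
  have bij: "bij_betw h ?U ?U"
    using h by (simp add: isomorphism_def universe_gen_product_s)
  have h_U: "h p \<in> ?U" if "p \<in> ?U" for p
    using bij that by (auto simp: bij_betw_def)
  have a': "a' \<in> universe M"
    using h_U[of "(a, b0)"] a h0 by auto
  have h_interp: "xs \<in> interp (gen_product_s M N) R \<longleftrightarrow> map h xs \<in> interp (gen_product_s M N) R"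
    if "R \<in> symbols (lang_s L)" "set xs \<subseteq> ?U" "length xs = arity (lang_s L) R" for R xs
    using h that by (simp add: isomorphism_def tuples_def universe_gen_product_s)
  \<comment> \<open>Being \<open>s\<close>-related to the reference point \<open>(a, b0)\<close>
    detects the fibre over \<open>a\<close>, and \<open>h\<close> carries this to the fibre over
    \<open>a'\<close>.\<close>
  have fst_h: "fst (h p) = a' \<longleftrightarrow> fst p = a" if "p \<in> ?U" for p
  proof -
    have "[p, (a, b0)] \<in> interp (gen_product_s M N) None \<longleftrightarrow>
        map h [p, (a, b0)] \<in> interp (gen_product_s M N) None"
      using that a by (intro h_interp) (auto simp: lang_s_def)
    then show ?thesis
      using that a h0 h_U[of p] h_U[of "(a, b0)"] by (simp add: interp_gen_product_s_None)
  qed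
  define g where "g b = snd (h (a, b))" for b
  have hg: "h (a, b) = (a', g b)" if "b \<in> universe (N a)" for b
    using fst_h[of "(a, b)"] a(1) that by (auto simp: g_def prod_eq_iff)
  have "isomorphism L (N a) (N a') g"
    unfolding isomorphism_def
  proof (intro conjI ballI)
    show "bij_betw g (universe (N a)) (universe (N a'))"
      unfolding bij_betw_def
    proof (intro conjI inj_onI equalityI subsetI)
      fix b c
      assume bc: "b \<in> universe (N a)" "c \<in> universe (N a)" "g b = g c"
      then have "h (a, b) = h (a, c)"
        using hg by simp
      moreover have "(a, b) \<in> ?U" "(a, c) \<in> ?U"
        using bc a(1) by auto
      ultimately have "(a, b) = (a, c)"
        using bij unfolding bij_betw_def by (auto dest: inj_onD)
      then show "b = c"
        by simp
    next
      fix d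
      assume "d \<in> g ` universe (N a)"
      then obtain b where "b \<in> universe (N a)" "d = g b"
        by blast
      then show "d \<in> universe (N a')"
        using h_U[of "(a, b)"] hg[of b] a(1) by auto
    next
      fix d
      assume "d \<in> universe (N a')"
      then have "(a', d) \<in> h ` ?U"
        using bij a' by (simp add: bij_betw_def)
      then obtain p where p: "p \<in> ?U" "h p = (a', d)"
        by auto
      then have "p = (a, snd p)"
        using fst_h[of p] by (simp add: prod_eq_iff)
      then show "d \<in> g ` universe (N a)"
        using p hg[of "snd p"] by (intro image_eqI[of _ _ "snd p"]) auto
    qed
    fix R bs
    assume R: "R \<in> symbols L" and bs: "bs \<in> tuples (universe (N a)) (arity L R)"
    show "bs \<in> interp (N a) R \<longleftrightarrow> map g bs \<in> interp (N a') R"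
    proof (cases "bs = []")
      case True
      then show ?thesis
        using Nil R by simp
    next
      case False
      \<comment> \<open>Lifted to the fibre over \<open>a\<close>, the nonempty \<open>bs\<close>
        has a constant base point, so product and fibre agree on it; the same holds for its image
        over \<open>a'\<close>.\<close>
      let ?ps = "map (Pair a) bs"
      have ps: "set ?ps \<subseteq> ?U"
        using bs a(1) by (auto simp: tuples_def)
      then have hps: "set (map h ?ps) \<subseteq> ?U"
        using h_U unfolding set_map by blast
      have "map snd (map h ?ps) = map g bs" "\<forall>p\<in>set (map h ?ps). fst p = a'"
        using bs hg by (auto simp: tuples_def)
      moreover have "map snd ?ps = bs"
        by (simp add: comp_def)
      moreover have "?ps \<in> interp (gen_product M N) R \<longleftrightarrow> map h ?ps \<in> interp (gen_product M N) R"
        using h_interp[of "Some R" ?ps] R bs ps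
        by (simp add: interp_gen_product_s_Some lang_s_def tuples_def)
      ultimately show ?thesis
        using interp_gen_product_fibre[OF ps, of a R] interp_gen_product_fibre[OF hps, of a' R] False
        by (simp del: map_map)
    qed
  qed
  then show ?thesis
    by (auto simp: isomorphic_def)
qed

section \<open>Indivisibility and failure of transitivity of the product\<close>

theorem theorem3p5:
  fixes L :: "'r rlang"
    and M M1 M' :: "('r, 'a) rstruct"
    and N0 N1 :: "('r, 'b) rstruct"
    and N :: "'a \<Rightarrow> ('r, 'b) rstruct"
  assumes "transitive_structure L M"
    and "elementarily_indivisible L M"
    and "elementarily_indivisible_pair L N0 N1"
    and "substructure L M1 M" and "universe M1 \<noteq> universe M"
    and "substructure L M' M1"
    and "isomorphic L M' M"
    and "elementary_substructure L M' M"
    and N_def: "\<And>a. a \<in> universe M \<Longrightarrow> N a = (if a \<in> universe M1 then N1 else N0)"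
  shows "elementarily_indivisible (lang_s L) (gen_product_s M N) \<and>
    \<not> transitive_structure (lang_s L) (gen_product_s M N)"
proof
  have N1: "elementarily_indivisible L N1" and N01: "elementary_substructure L N0 N1"
    and not_iso: "\<not> isomorphic L N0 N1"
    using assms(3) by (auto simp: elementarily_indivisible_pair_def)
  note struct_N0 = elementary_substructureD(1)[OF N01] and struct_N1 = elementary_substructureD(2)[OF N01]
  note struct_M' = elementary_substructureD(1)[OF assms(8)] and struct_M = elementary_substructureD(2)[OF assms(8)]
  have M1_M: "universe M1 \<subseteq> universe M" and M'_M1: "universe M' \<subseteq> universe M1"
    using assms(4,6) by (auto simp: substructure_def)
  \<comment> \<open>Either value of \<open>N\<close> is elementary in \<open>N1\<close>. This makes
    \<open>N1\<close> the common extension \<open>K\<close> of all fibres and lets every fibre be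
    embedded into a copy of \<open>N1\<close>.\<close>
  have N_N1: "elementary_substructure L (N a) N1" if "a \<in> universe M" for a
    using N_def[OF that] N01 elementary_substructure_refl[OF struct_N1] by simp
  show "elementarily_indivisible (lang_s L) (gen_product_s M N)"
    unfolding elementarily_indivisible_def
  proof (intro conjI allI)
    show "is_structure (lang_s L) (gen_product_s M N)"
      by (intro is_structure_gen_product_s struct_M elementary_substructureD(1)[OF N_N1])
    fix c :: "'a \<times> 'b \<Rightarrow> bool"
    have "\<exists>A k. elementary_substructure L A N1 \<and> isomorphic L A N1 \<and> (\<forall>b\<in>universe A. c (a, b) = k)" for a
      using N1 unfolding elementarily_indivisible_def by (elim conjE allE[of _ "\<lambda>b. c (a, b)"]) blast
    then obtain A k where A: "\<And>a. elementary_substructure L (A a) N1" "\<And>a. isomorphic L (A a) N1"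
      "\<And>a b. b \<in> universe (A a) \<Longrightarrow> c (a, b) = k a"
      by metis
    \<comment> \<open>The colors \<open>k a\<close> induce a coloring of \<open>M'\<close>, to which
      the indivisibility inherited from \<open>M\<close> applies.\<close>
    have "elementarily_indivisible L M'"
      using elementarily_indivisible_isomorphic[OF assms(2) isomorphic_sym[OF assms(7)] struct_M'] .
    then obtain P col where P: "elementary_substructure L P M'" "isomorphic L P M'"
      "\<forall>a\<in>universe P. k a = col"
      unfolding elementarily_indivisible_def by blast
    have P_M: "elementary_substructure L P M"
      using elementary_substructure_trans[OF P(1) assms(8)] .
    have P_M1: "universe P \<subseteq> universe M1"
      using elementary_substructureD(3)[OF P(1)] M'_M1 by simp
    obtain f where f: "isomorphism L M P f"
      using isomorphic_sym[OF isomorphic_trans[OF P(2) assms(7)]] by (auto simp: isomorphic_def)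
    then have bij_f: "bij_betw f (universe M) (universe P)"
      by (simp add: isomorphism_def)
    \<comment> \<open>An isomorphism from \<open>N1\<close> onto the monochromatic copy over
      \<open>f x\<close> carries the elementary substructure \<open>N x\<close> into that
      copy.\<close>
    have "\<exists>B. elementary_substructure L B (A (f x)) \<and> isomorphic L (N x) B" if x: "x \<in> universe M" for x
    proof -
      obtain h where h: "isomorphism L N1 (A (f x)) h"
        using isomorphic_sym[OF A(2)] by (auto simp: isomorphic_def)
      obtain B where "elementary_substructure L B (A (f x))" "isomorphism L (N x) B h"
        using elementary_substructure_image[OF h N_N1[OF x] elementary_substructureD(1)[OF A(1)]] .
      then show ?thesis
        by (auto simp: isomorphic_def)
    qed
    then obtain B0 where B0: "\<And>x. x \<in> universe M \<Longrightarrow>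
        elementary_substructure L (B0 x) (A (f x)) \<and> isomorphic L (N x) (B0 x)"
      by metis
    \<comment> \<open>The copies are indexed by points of \<open>M\<close>, but a product over
      \<open>P\<close> needs them indexed by points of \<open>P\<close>.\<close>
    define B where "B a = B0 (inv_into (universe M) f a)" for a
    have inv: "inv_into (universe M) f a \<in> universe M" "f (inv_into (universe M) f a) = a"
      if "a \<in> universe P" for a
      using bij_f that by (auto simp: bij_betw_def inv_into_into f_inv_into_f)
    have B_A: "elementary_substructure L (B a) (A a)" if "a \<in> universe P" for a
      using B0[OF inv(1)[OF that]] inv(2)[OF that] by (simp add: B_def)
    have "isomorphic L (N x) (B (f x))" if "x \<in> universe M" for x
      using B0[OF that] bij_f that by (simp add: B_def bij_betw_def)
    then obtain g where g: "\<And>x. x \<in> universe M \<Longrightarrow> isomorphism L (N x) (B (f x)) (g x)"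
      unfolding isomorphic_def by metis
    let ?Q = "gen_product_s P B"
    \<comment> \<open>Since \<open>P\<close> lies inside \<open>M1\<close>, the ambient fibre over
      each of its points is \<open>N1\<close>, in which \<open>A a\<close> and hence
      \<open>B a\<close> are elementary.\<close>
    have "elementary_substructure (lang_s L) ?Q (gen_product_s M N)"
    proof (rule elementary_substructure_gen_product_s[OF P_M _ N_N1])
      fix a
      assume a: "a \<in> universe P"
      then have "a \<in> universe M1" "a \<in> universe M"
        using P_M1 M1_M by blast+
      then have "N a = N1"
        using N_def by simp
      then show "elementary_substructure L (B a) (N a)"
        using elementary_substructure_trans[OF B_A[OF a] A(1)] by simp
    qed
    moreover have "isomorphism (lang_s L) (gen_product_s M N) ?Q (\<lambda>(a, b). (f a, g a b))"
      using f g by (rule isomorphism_gen_product_s)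
    then have "isomorphic (lang_s L) ?Q (gen_product_s M N)"
      using isomorphic_sym unfolding isomorphic_def by blast
    moreover have "c p = col" if p_Q: "p \<in> universe ?Q" for p
    proof -
      obtain a b where p: "p = (a, b)" "a \<in> universe P" "b \<in> universe (B a)"
        using p_Q by (auto simp: universe_gen_product_s)
      then have "b \<in> universe (A a)"
        using elementary_substructureD(3)[OF B_A] by auto
      then show ?thesis
        using A(3) P(3) p(1,2) by simp
    qed
    ultimately show "\<exists>Q. elementary_substructure (lang_s L) Q (gen_product_s M N) \<and>
        isomorphic (lang_s L) Q (gen_product_s M N) \<and> (\<exists>k. \<forall>p\<in>universe Q. c p = k)"
      by (intro exI[of _ ?Q] conjI exI[of _ col] ballI)
  qed
  show "\<not> transitive_structure (lang_s L) (gen_product_s M N)"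
  proof
    assume trans: "transitive_structure (lang_s L) (gen_product_s M N)"
    obtain a where a: "a \<in> universe M1"
      using assms(4) by (auto simp: substructure_def is_structure_def)
    obtain a' where a': "a' \<in> universe M" "a' \<notin> universe M1"
      using assms(5) M1_M by blast
    have Na: "N a = N1" "N a' = N0"
      using N_def a a' M1_M by auto
    obtain b b' where b: "b \<in> universe N1" "b' \<in> universe N0"
      using struct_N0 struct_N1 by (auto simp: is_structure_def)
    have "(a, b) \<in> universe (gen_product_s M N)" "(a', b') \<in> universe (gen_product_s M N)"
      using a a' b M1_M Na by (auto simp: universe_gen_product_s)
    then obtain h where h: "isomorphism (lang_s L) (gen_product_s M N) (gen_product_s M N) h"
      "h (a, b) = (a', b')"
      using trans unfolding transitive_structure_def by blast
    \<comment> \<open>The empty tuple lies over every universe, so a substructure has the same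
      nullary facts.\<close>
    have "[] \<in> interp N1 R \<longleftrightarrow> [] \<in> interp N0 R" if R: "R \<in> symbols L" for R
    proof -
      have "interp N1 R \<subseteq> tuples (universe N1) (arity L R)"
        using struct_N1 R by (simp add: is_structure_def)
      moreover have "interp N0 R = interp N1 R \<inter> tuples (universe N0) (arity L R)"
        using N01 R by (simp add: elementary_substructure_def substructure_def)
      ultimately show ?thesis
        by (auto simp: tuples_def)
    qed
    then have "isomorphic L (N a) (N a')"
      using a b M1_M Na by (intro isomorphic_fibres[OF h]) auto
    then show False
      using not_iso isomorphic_sym Na by metis
  qed
qed

end
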